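(* Let ${\cal D}^*_{C,m}$ be the digraph (defined in the context) with vertex set $\{0,1\}^m$. (i) For each even integer $m\ge 2$, the digraph ${\cal D}^*_{C,m}$ has exactly $\lfloor m/2\rfloor+1$ components, i.e. ${\cal D}^*_{C,m}={\cal A}^*_{C,m}\cup\bigl(\bigcup_{s=1}^{\lfloor m/2\rfloor}{\cal B}^{*(s)}_{C,m}\bigr)$ for a suitable labelling of the components, where: the component ${\cal A}^*_{C,m}$ contains both words $1^m$ and $0^m$; every component ${\cal B}^{*(s)}_{C,m}$ ($1\le s\le \lfloor m/2\rfloor$) is a bipartite digraph; and $$|V({\cal B}^{*(s)}_{C,m})|=2\binom{m}{m/2-s}\quad(1\le s\le \lfloor m/2\rfloor),\qquad |V({\cal A}^*_{C,m})|=\binom{m}{m/2}.$$ (ii) For each odd integer $m\ge 1$, the digraph ${\cal D}^*_{C,m}$ has exactly two components, ${\cal D}^*_{C,m}={\cal A}^*_{C,m}\cup{\cal N}^*_m$, where ${\cal A}^*_{C,m}$ is the component containing $1^m$ and ${\cal N}^*_m$ is the component containing $0^m$; these two components are isomorphic to each other and each has $2^{m-1}$ vertices.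
   Context: Alphabet. Each letter of $\{a,b,c,d,e,f\}$ encodes which two of the four directions (up, down, left, right) are occupied at a grid vertex: $a$ = {right, down}, $b$ = {up, down}, $c$ = {right, up}, $d$ = {left, down}, $e$ = {left, right}, $f$ = {left, up}. Digraphs on the alphabet. In ${\cal D}_{ud}$ there is an arc $(x,y)$ iff ($x$ contains "down" $\Leftrightarrow$ $y$ contains "up"), i.e. iff ($x\in\{a,b,d\}\Leftrightarrow y\in\{b,c,f\}$). In ${\cal D}_{lr}$ there is an arc $(x,y)$ iff ($x$ contains "right" $\Leftrightarrow$ $y$ contains "left"), i.e. iff ($x\in\{a,c,e\}\Leftrightarrow y\in\{d,e,f\}$). Digraph ${\cal D}_{C,m}$. For $m\ge1$, $V({\cal D}_{C,m})$ is the set of words $\alpha=\alpha_1\alpha_2\ldots\alpha_m$ over $\{a,b,c,d,e,f\}$ such that $(\alpha_i,\alpha_{i+1})$ is an arc of ${\cal D}_{ud}$ for all $1\le i\le m$, where $\alpha_{m+1}:=\alpha_1$ (circular words). There is an arc $\alpha\to\beta$ in ${\cal D}_{C,m}$ iff $(\alpha_i,\beta_i)$ is an arc of ${\cal D}_{lr}$ for all $1\le i\le m$. Outlet and inlet words. For $\alpha\in V({\cal D}_{C,m})$, the outlet word $o(\alpha)=o_1\ldots o_m$ and the inlet word $i(\alpha)=i_1\ldots i_m$ are the binary words with $o_j=1$ iff $\alpha_j\in\{a,c,e\}$ and $i_j=1$ iff $\alpha_j\in\{d,e,f\}$. Thus $\alpha\to\beta$ in ${\cal D}_{C,m}$ iff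 $o(\alpha)=i(\beta)$. Digraph ${\cal D}^*_{C,m}$. It is obtained from ${\cal D}_{C,m}$ by gluing all vertices having the same outlet word (this word becomes the vertex of the new digraph) and replacing all arcs that start from these glued vertices and end at the same vertex of ${\cal D}_{C,m}$ by only one arc. Equivalently, its vertex set is $\{0,1\}^m$, and the number of arcs (loops and multiple arcs allowed) from $v$ to $w$ is the number of words $\alpha\in V({\cal D}_{C,m})$ with $i(\alpha)=v$ and $o(\alpha)=w$. Its adjacency matrix is symmetric, so weakly connected components and strongly connected components coincide; "component" means such a component. Conventions. $0^m$ and $1^m$ are the constant words of length $m$. A digraph is bipartite if its vertex set can be partitioned into two classes such that every arc joins vertices of different classes (in particular there are no loops). Isomorphism of digraphs preserves the number of arcs between ordered pairs of vertices. *)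

theory Defs
  imports "Graph_Theory.Graph_Theory"
begin

datatype direction = Up | Down | Left | Right

datatype letter = La | Lb | Lc | Ld | Le | Lf

fun occupied :: "letter \<Rightarrow> direction set" where
  "occupied La = {Right, Down}"
| "occupied Lb = {Up, Down}"
| "occupied Lc = {Right, Up}"
| "occupied Ld = {Left, Down}"
| "occupied Le = {Left, Right}"
| "occupied Lf = {Left, Up}"

definition D_ud :: "letter pair_pre_digraph" where
  "D_ud = \<lparr> pverts = UNIV, parcs = {(x, y). Down \<in> occupied x \<longleftrightarrow> Up \<in> occupied y} \<rparr>"

definition D_lr :: "letter pair_pre_digraph" where
  "D_lr = \<lparr> pverts = UNIV, parcs = {(x, y). Right \<in> occupied x \<longleftrightarrow> Left \<in> occupied y} \<rparr>"

definition circular_words :: "nat \<Rightarrow> letter list set" where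
  "circular_words m =
     {\<alpha>. length \<alpha> = m \<and> (\<forall>i<m. (\<alpha> ! i, \<alpha> ! (Suc i mod m)) \<in> parcs D_ud)}"

definition D_C :: "nat \<Rightarrow> letter list pair_pre_digraph" where
  "D_C m = \<lparr> pverts = circular_words m,
     parcs = {(\<alpha>, \<beta>). \<alpha> \<in> circular_words m \<and> \<beta> \<in> circular_words m
                \<and> (\<forall>i<m. (\<alpha> ! i, \<beta> ! i) \<in> parcs D_lr)} \<rparr>"

text \<open>Binary words are lists of Booleans, with \<^term>\<open>True\<close> standing for 1.\<close>

definition outlet :: "letter list \<Rightarrow> bool list" where
  "outlet \<alpha> = map (\<lambda>x. Right \<in> occupied x) \<alpha>"

definition inlet :: "letter list \<Rightarrow> bool list" where
  "inlet \<alpha> = map (\<lambda>x. Left \<in> occupied x) \<alpha>"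

text \<open>
  Vertices of \<^term>\<open>D_C m\<close> with the same outlet word are glued. The arcs that start in the class
  of outlet word \<open>v\<close> and end at the same vertex \<open>\<beta>\<close> of \<^term>\<open>D_C m\<close> become the single arc
  \<open>(v, \<beta>)\<close>, which leads from \<open>v\<close> to the class of \<open>\<beta>\<close>. Arcs with distinct \<open>\<beta>\<close> stay distinct,
  hence parallel arcs are possible.
\<close>

definition DstarC :: "nat \<Rightarrow> (bool list, bool list \<times> letter list) pre_digraph" where
  "DstarC m = \<lparr> verts = outlet ` pverts (D_C m),
     arcs = {(outlet \<alpha>, \<beta>) | \<alpha> \<beta>. (\<alpha>, \<beta>) \<in> parcs (D_C m)},
     tail = fst, head = (\<lambda>(v, \<beta>). outlet \<beta>) \<rparr>"

definition bipartite_digraph :: "('a, 'b) pre_digraph \<Rightarrow> bool" where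
  "bipartite_digraph G \<longleftrightarrow> (\<exists>U W. verts G = U \<union> W \<and> U \<inter> W = {} \<and>
     (\<forall>e\<in>arcs G. (tail G e \<in> U \<and> head G e \<in> W) \<or> (tail G e \<in> W \<and> head G e \<in> U)))"


lemma length_outlet [simp]: "length (outlet \<alpha>) = length \<alpha>"
  by (simp add: outlet_def)

lemma length_inlet [simp]: "length (inlet \<alpha>) = length \<alpha>"
  by (simp add: inlet_def)

lemma D_C_arc_iff:
  "(\<alpha>, \<beta>) \<in> parcs (D_C m) \<longleftrightarrow>
     \<alpha> \<in> circular_words m \<and> \<beta> \<in> circular_words m \<and> outlet \<alpha> = inlet \<beta>"
proof -
  have "outlet \<alpha> = inlet \<beta> \<longleftrightarrow> (\<forall>i<m. (\<alpha> ! i, \<beta> ! i) \<in> parcs D_lr)"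
    if "length \<alpha> = m" "length \<beta> = m"
    using that unfolding list_eq_iff_nth_eq[of "outlet \<alpha>"]
    by (simp add: outlet_def inlet_def D_lr_def)
  moreover have "length \<gamma> = m" if "\<gamma> \<in> circular_words m" for \<gamma>
    using that by (simp add: circular_words_def)
  ultimately show ?thesis
    unfolding D_C_def by auto
qed

lemma outlet_surj:
  assumes "m \<ge> 1" "length w = m"
  shows "\<exists>\<alpha>\<in>circular_words m. outlet \<alpha> = w"
proof -
  define l where "l i = (if i = 0 \<and> odd m then (if w ! 0 then Le else Lb)
      else if w ! i then (if even i \<noteq> w ! 0 then La else Lc)
      else (if even i \<noteq> w ! 0 then Ld else Lf))" for i
  let ?\<alpha> = "map l [0..<m]"
  have down: "Down \<in> occupied (l i) \<longleftrightarrow> even i \<noteq> w ! 0" for i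
    by (auto simp: l_def)
  have up: "Up \<in> occupied (l (Suc i mod m)) \<longleftrightarrow> even i \<noteq> w ! 0" if "i < m" for i
  proof (cases "Suc i = m")
    case True
    then show ?thesis by (auto simp: l_def)
  next
    case False
    with that have "Suc i mod m = Suc i" by simp
    then show ?thesis by (auto simp: l_def)
  qed
  have "?\<alpha> \<in> circular_words m"
    using assms down up by (auto simp: circular_words_def D_ud_def)
  moreover have "outlet ?\<alpha> = w"
    using assms by (auto simp: outlet_def list_eq_iff_nth_eq l_def)
  ultimately show ?thesis by blast
qed

lemma verts_DstarC:
  assumes "m \<ge> 1"
  shows "verts (DstarC m) = {w. length w = m}"
proof -
  have "outlet ` circular_words m = {w. length w = m}"
  proof (intro equalityI subsetI)
    fix w assume "w \<in> outlet ` circular_words m"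
    then show "w \<in> {w. length w = m}" by (auto simp: circular_words_def)
  next
    fix w :: "bool list" assume "w \<in> {w. length w = m}"
    then show "w \<in> outlet ` circular_words m" using outlet_surj[OF assms, of w] by blast
  qed
  then show ?thesis by (simp add: DstarC_def D_C_def)
qed

lemma card_arcs_DstarC:
  assumes "m \<ge> 1"
  shows "card {e \<in> arcs (DstarC m). tail (DstarC m) e = v \<and> head (DstarC m) e = w}
    = card {\<alpha> \<in> circular_words m. inlet \<alpha> = v \<and> outlet \<alpha> = w}"
proof -
  have pre: "\<exists>\<alpha>\<in>circular_words m. outlet \<alpha> = inlet \<beta>" if "\<beta> \<in> circular_words m" for \<beta>
    using outlet_surj[OF assms, of "inlet \<beta>"] that by (simp add: circular_words_def)
  have "{e \<in> arcs (DstarC m). tail (DstarC m) e = v \<and> head (DstarC m) e = w}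
      = Pair v ` {\<alpha> \<in> circular_words m. inlet \<alpha> = v \<and> outlet \<alpha> = w}" (is "?E = ?P")
  proof (intro equalityI subsetI)
    fix e assume "e \<in> ?E"
    then show "e \<in> ?P" by (auto simp: DstarC_def D_C_arc_iff)
  next
    fix e assume "e \<in> ?P"
    then obtain \<beta> where \<beta>: "e = (v, \<beta>)" "\<beta> \<in> circular_words m" "inlet \<beta> = v" "outlet \<beta> = w"
      by blast
    with pre obtain \<alpha> where \<alpha>: "\<alpha> \<in> circular_words m" "outlet \<alpha> = inlet \<beta>" by blast
    have "(outlet \<alpha>, \<beta>) \<in> arcs (DstarC m)"
    proof -
      have "(\<alpha>, \<beta>) \<in> parcs (D_C m)" using \<alpha> \<beta>(2) by (simp add: D_C_arc_iff)
      then show ?thesis unfolding DstarC_def by auto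
    qed
    then show "e \<in> ?E" using \<alpha> \<beta> by (simp add: DstarC_def)
  qed
  moreover have "inj_on (Pair v) X" for X :: "letter list set"
    by (rule inj_onI) simp
  ultimately show ?thesis by (simp only: card_image)
qed

fun mirror :: "letter \<Rightarrow> letter" where
  "mirror La = Ld"
| "mirror Lb = Lb"
| "mirror Lc = Lf"
| "mirror Ld = La"
| "mirror Le = Le"
| "mirror Lf = Lc"

lemma occupied_mirror [simp]:
  "Up \<in> occupied (mirror x) \<longleftrightarrow> Up \<in> occupied x"
  "Down \<in> occupied (mirror x) \<longleftrightarrow> Down \<in> occupied x"
  "Left \<in> occupied (mirror x) \<longleftrightarrow> Right \<in> occupied x"
  "Right \<in> occupied (mirror x) \<longleftrightarrow> Left \<in> occupied x"
  by (cases x; simp)+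

lemma mirror_mirror [simp]: "mirror (mirror x) = x"
  by (cases x) auto

lemma inlet_map_mirror: "inlet (map mirror \<alpha>) = outlet \<alpha>"
  by (simp add: inlet_def outlet_def)

lemma outlet_map_mirror: "outlet (map mirror \<alpha>) = inlet \<alpha>"
  by (simp add: inlet_def outlet_def)

lemma map_mirror_circular:
  assumes "\<alpha> \<in> circular_words m"
  shows "map mirror \<alpha> \<in> circular_words m"
proof -
  have "(map mirror \<alpha> ! i, map mirror \<alpha> ! (Suc i mod m)) \<in> parcs D_ud" if "i < m" for i
  proof -
    have "Suc i mod m < m" using that by simp
    then show ?thesis
      using assms that by (simp add: circular_words_def D_ud_def)
  qed
  then show ?thesis
    using assms by (simp add: circular_words_def)
qed

lemma map_mirror_map_mirror: "map mirror (map mirror \<alpha>) = \<alpha>"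
  by (induction \<alpha>) simp_all

lemma adjacency_symmetric:
  assumes "m \<ge> 1"
  shows "card {e \<in> arcs (DstarC m). tail (DstarC m) e = v \<and> head (DstarC m) e = w}
    = card {e \<in> arcs (DstarC m). tail (DstarC m) e = w \<and> head (DstarC m) e = v}"
  unfolding card_arcs_DstarC[OF assms]
proof (rule bij_betw_same_card[of "map mirror"])
  show "bij_betw (map mirror) {\<alpha> \<in> circular_words m. inlet \<alpha> = v \<and> outlet \<alpha> = w}
      {\<alpha> \<in> circular_words m. inlet \<alpha> = w \<and> outlet \<alpha> = v}"
    by (rule bij_betw_byWitness[where f' = "map mirror"])
      (simp_all add: map_mirror_map_mirror del: map_map add: image_subset_iff map_mirror_circular
        inlet_map_mirror outlet_map_mirror)
qed

end

theory Submission
  imports Defs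
begin

text \<open>
  Every grid vertex has degree two, so along an arc \<open>v \<rightarrow> w\<close> with vertical edges \<open>d\<close> we have
  \<open>v i + w i + d (i - 1) + d i = 2\<close> for all cyclic indices \<open>i\<close>. For even \<open>m\<close> the alternating sum over \<open>i\<close>
  cancels the vertical edges: if \<open>k v\<close> counts the positions where \<open>v\<close> differs from the word
  \<open>0101...\<close>, then \<open>k v + k w = m\<close>, so \<open>\<bar>k v - m / 2\<bar>\<close> is constant on components, and the arcs
  alternate between \<open>m / 2 - s\<close> and \<open>m / 2 + s\<close>. For odd \<open>m\<close> only the parity of the number of ones
  survives. These are the only invariants: complementing a word, combined with flipping one agreeing
  and one differing position (\<open>m\<close> even) or with flipping any single position (\<open>m\<close> odd), is always an
  arc, and two such steps realise enough transpositions or double flips to connect all words with the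
  same invariant. For odd \<open>m\<close> complementing every letter interchanges the two components.
\<close>

section \<open>Strong components as level sets\<close>

context wf_digraph
begin

text \<open>Under this hypothesis reachability is symmetric, so the strong component of
  \<open>u\<close> is the fibre of \<open>f\<close> through \<open>u\<close>.\<close>

lemma sccs_eq_levels:
  assumes "\<And>u v. u \<in> verts G \<Longrightarrow> v \<in> verts G \<Longrightarrow> u \<rightarrow>\<^sup>* v \<longleftrightarrow> f u = f v"
  shows "sccs = (\<lambda>k. G \<restriction> {v \<in> verts G. f v = k}) ` f ` verts G"
proof -
  have "scc_of u = {v \<in> verts G. f v = f u}" if "u \<in> verts G" for u
  proof (intro set_eqI)
    fix v
    have "v \<in> scc_of u \<longleftrightarrow> v \<in> verts G \<and> u \<rightarrow>\<^sup>* v \<and> v \<rightarrow>\<^sup>* u"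
      using reachable_in_verts(2)[of u v] by (auto simp: scc_of_def)
    then show "v \<in> scc_of u \<longleftrightarrow> v \<in> {v \<in> verts G. f v = f u}"
      using assms[of u v] assms[of v u] that by auto
  qed
  then have "sccs_verts = (\<lambda>k. {v \<in> verts G. f v = k}) ` f ` verts G"
    by (simp add: sccs_verts_conv_scc_of image_image)
  then show ?thesis
    by (simp add: sccs_conv_sccs_verts image_image)
qed

text \<open>Only attained values index the levels, so each level is nonempty and determines its
  value.\<close>

lemma card_levels:
  "card ((\<lambda>k. G \<restriction> {v \<in> verts G. f v = k}) ` f ` verts G) = card (f ` verts G)"
proof (rule card_image, rule inj_onI)
  fix k l
  assume "k \<in> f ` verts G"
    and eq: "G \<restriction> {v \<in> verts G. f v = k} = G \<restriction> {v \<in> verts G. f v = l}"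
  then obtain u where "u \<in> {v \<in> verts G. f v = k}" by blast
  moreover have "{v \<in> verts G. f v = k} = {v \<in> verts G. f v = l}"
    using arg_cong[OF eq, of verts] by simp
  ultimately show "k = l" by blast
qed

text \<open>An arc whose ends agree under \<open>f\<close> lies inside one level, so cutting into
  levels loses no arc.\<close>

lemma Union_levels:
  assumes "\<And>e. e \<in> arcs G \<Longrightarrow> f (tail G e) = f (head G e)"
  shows "Union ((\<lambda>k. G \<restriction> {v \<in> verts G. f v = k}) ` f ` verts G) = G"
proof -
  have "\<exists>v\<in>verts G. f (head G e) = f v" if "e \<in> arcs G" for e
    using that head_in_verts by blast
  then show ?thesis
    using assms by (intro pre_digraph.equality) (auto simp: Union_def)
qed

end

section \<open>Arcs between binary words\<close>

text \<open>The six letters are exactly the two-element sets of directions.\<close>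

lemma letter_exists:
  fixes l r u d :: bool
  assumes "of_bool l + of_bool r + of_bool u + of_bool d = (2::nat)"
  obtains x where "Left \<in> occupied x \<longleftrightarrow> l" "Right \<in> occupied x \<longleftrightarrow> r"
    "Up \<in> occupied x \<longleftrightarrow> u" "Down \<in> occupied x \<longleftrightarrow> d"
proof -
  have "\<exists>x\<in>{La, Lb, Lc, Ld, Le, Lf}. (Left \<in> occupied x \<longleftrightarrow> l) \<and> (Right \<in> occupied x \<longleftrightarrow> r) \<and>
      (Up \<in> occupied x \<longleftrightarrow> u) \<and> (Down \<in> occupied x \<longleftrightarrow> d)"
    using assms by (cases l; cases r; cases u; cases d) simp_all
  then show thesis using that by blast
qed

lemma occupied_degree:
  "of_bool (Left \<in> occupied x) + of_bool (Right \<in> occupied x)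
    + of_bool (Up \<in> occupied x) + of_bool (Down \<in> occupied x) = (2::nat)"
  by (cases x) simp_all

text \<open>Gluing loses no arc of this kind: by \<open>outlet_surj\<close> every word
  \<open>v\<close> of length \<open>m\<close> is an outlet word, so each circular word with inlet
  \<open>v\<close> is the end of an arc from \<open>v\<close>.\<close>

lemma dominates_DstarC_iff:
  assumes "m \<ge> 1"
  shows "v \<rightarrow>\<^bsub>DstarC m\<^esub> w \<longleftrightarrow> (\<exists>\<alpha>\<in>circular_words m. inlet \<alpha> = v \<and> outlet \<alpha> = w)"
proof
  assume "v \<rightarrow>\<^bsub>DstarC m\<^esub> w"
  then obtain e where "e \<in> arcs (DstarC m)" "tail (DstarC m) e = v" "head (DstarC m) e = w"
    by (auto simp: arcs_ends_conv)
  then show "\<exists>\<alpha>\<in>circular_words m. inlet \<alpha> = v \<and> outlet \<alpha> = w"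
    by (auto simp: DstarC_def D_C_arc_iff)
next
  assume "\<exists>\<alpha>\<in>circular_words m. inlet \<alpha> = v \<and> outlet \<alpha> = w"
  then obtain \<beta> where \<beta>: "\<beta> \<in> circular_words m" "inlet \<beta> = v" "outlet \<beta> = w" by blast
  then have "length v = m" by (auto simp: circular_words_def)
  then obtain \<alpha> where "\<alpha> \<in> circular_words m" "outlet \<alpha> = v"
    using outlet_surj[OF assms] by blast
  with \<beta> have "(v, \<beta>) \<in> arcs (DstarC m)"
    by (force simp: DstarC_def D_C_arc_iff)
  moreover have "tail (DstarC m) (v, \<beta>) = v" "head (DstarC m) (v, \<beta>) = w"
    using \<beta> by (simp_all add: DstarC_def)
  ultimately show "v \<rightarrow>\<^bsub>DstarC m\<^esub> w"
    by (force simp: arcs_ends_conv)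
qed

text \<open>
  A column of the grid is described by the occupation of its vertical edges: \<open>d i\<close> for the edge
  below and \<open>u i\<close> for the edge above vertex \<open>i\<close>. Horizontal and vertical occupation together fix
  the letters.
\<close>

lemma dominates_DstarCI:
  assumes "m \<ge> 1" "length v = m" "length w = m"
    and ud: "\<And>i. i < m \<Longrightarrow> u (Suc i mod m) = d i"
    and deg: "\<And>i. i < m \<Longrightarrow>
      of_bool (v ! i) + of_bool (w ! i) + of_bool (u i) + of_bool (d i) = (2::nat)"
  shows "v \<rightarrow>\<^bsub>DstarC m\<^esub> w"
proof -
  have "\<exists>x. (Left \<in> occupied x \<longleftrightarrow> v ! i) \<and> (Right \<in> occupied x \<longleftrightarrow> w ! i) \<and>
      (Up \<in> occupied x \<longleftrightarrow> u i) \<and> (Down \<in> occupied x \<longleftrightarrow> d i)" if "i < m" for i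
    using letter_exists[OF deg[OF that]] by metis
  then obtain x where x: "\<And>i. i < m \<Longrightarrow> (Left \<in> occupied (x i) \<longleftrightarrow> v ! i) \<and>
      (Right \<in> occupied (x i) \<longleftrightarrow> w ! i) \<and> (Up \<in> occupied (x i) \<longleftrightarrow> u i) \<and>
      (Down \<in> occupied (x i) \<longleftrightarrow> d i)"
    by metis
  let ?\<alpha> = "map x [0..<m]"
  have "?\<alpha> \<in> circular_words m"
    using x ud by (simp add: circular_words_def D_ud_def)
  moreover have "inlet ?\<alpha> = v" "outlet ?\<alpha> = w"
    using x assms(2,3) by (simp_all add: inlet_def outlet_def list_eq_iff_nth_eq)
  ultimately show ?thesis
    using dominates_DstarC_iff[OF assms(1)] by blast
qed

lemma wf_digraph_DstarC: "wf_digraph (DstarC m)"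
  by unfold_locales (auto simp: DstarC_def D_C_def)

text \<open>The cyclic shift permutes the indices. This identifies a total over upper edges with one
  over lower edges.\<close>

lemma sum_shift_mod:
  fixes f g :: "nat \<Rightarrow> 'a :: comm_monoid_add"
  assumes "\<And>i. i < m \<Longrightarrow> f (Suc i mod m) = g i"
  shows "sum f {..<m} = sum g {..<m}"
proof (cases m)
  case (Suc n)
  have "sum f {..<m} = f 0 + (\<Sum>i<n. f (Suc i))"
    unfolding Suc by (rule sum.lessThan_Suc_shift)
  also have "f 0 = g n" using assms[of n] Suc by simp
  also have "(\<Sum>i<n. f (Suc i)) = (\<Sum>i<n. g i)"
  proof (rule sum.cong)
    fix i assume "i \<in> {..<n}"
    then show "f (Suc i) = g i" using assms[of i] Suc by simp
  qed simp
  finally show ?thesis unfolding Suc by (simp add: add.commute)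
qed simp

lemma circular_words_Up:
  assumes "\<alpha> \<in> circular_words m" "i < m"
  shows "Up \<in> occupied (\<alpha> ! (Suc i mod m)) \<longleftrightarrow> Down \<in> occupied (\<alpha> ! i)"
  using assms by (simp add: circular_words_def D_ud_def)

text \<open>The pattern is a parameter because three are used: \<open>odd\<close> for the invariant
  of even length, constant \<open>False\<close> to count ones, and \<open>(!) w\<close> for the
  Hamming distance to \<open>w\<close>.\<close>

definition mismatches :: "(nat \<Rightarrow> bool) \<Rightarrow> bool list \<Rightarrow> nat set" where
  "mismatches p w = {i. i < length w \<and> w ! i \<noteq> p i}"

lemma finite_mismatches [simp]: "finite (mismatches p w)"
  by (simp add: mismatches_def)

lemma mismatches_subset: "mismatches p w \<subseteq> {..<length w}"
  by (auto simp: mismatches_def)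

lemma card_mismatches: "card (mismatches p w) = (\<Sum>i<length w. of_bool (w ! i \<noteq> p i))"
proof -
  have "mismatches p w = {i\<in>{..<length w}. w ! i \<noteq> p i}" by (auto simp: mismatches_def)
  then show ?thesis by (simp add: sum_of_bool_eq Int_def)
qed

lemma mismatches_map_Not: "mismatches p (map Not w) = {..<length w} - mismatches p w"
  by (auto simp: mismatches_def)

lemma card_mismatches_map_Not:
  "card (mismatches p (map Not w)) = length w - card (mismatches p w)"
  using card_Diff_subset[OF finite_mismatches mismatches_subset]
  by (simp add: mismatches_map_Not)

lemma bij_betw_mismatches: "bij_betw (mismatches p) {w. length w = m} (Pow {..<m})"
proof (rule bij_betw_byWitness[where f' = "\<lambda>S. map (\<lambda>i. (i \<in> S) \<noteq> p i) [0..<m]"])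
  show "\<forall>w\<in>{w. length w = m}. map (\<lambda>i. (i \<in> mismatches p w) \<noteq> p i) [0..<m] = w"
    by (auto simp: mismatches_def list_eq_iff_nth_eq)
qed (auto simp: mismatches_def)

text \<open>For a fixed pattern a word is the same as its mismatch set, so this counts the
  \<open>k\<close>-subsets of \<open>{..<m}\<close>.\<close>

lemma card_words_mismatches:
  "card {w. length w = m \<and> card (mismatches p w) = k} = m choose k"
proof -
  let ?W = "{w. length w = m \<and> card (mismatches p w) = k}"
  have inj: "inj_on (mismatches p) {w. length w = m}"
    and img: "mismatches p ` {w. length w = m} = Pow {..<m}"
    using bij_betw_mismatches[of p m] by (simp_all add: bij_betw_def)
  have "card ?W = card (mismatches p ` ?W)"
    by (rule card_image[symmetric], rule inj_on_subset[OF inj]) blast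
  also have "mismatches p ` ?W = {S \<in> mismatches p ` {w. length w = m}. card S = k}"
    by blast
  also have "\<dots> = {S. S \<subseteq> {..<m} \<and> card S = k}"
    by (simp add: img)
  finally show ?thesis
    using n_subsets[of "{..<m}" k] by simp
qed

lemma mismatches_flip:
  assumes "i < length w"
  shows "mismatches p (w[i := \<not> w ! i]) =
    (if w ! i = p i then insert i (mismatches p w) else mismatches p w - {i})"
  using assms by (auto simp: mismatches_def nth_list_update split: if_splits)

lemma mismatches_eq_iff:
  assumes "length v = length w"
  shows "mismatches p v = mismatches p w \<longleftrightarrow> v = w"
  using bij_betw_mismatches[of p "length w"] assms
  by (auto simp: bij_betw_def dest: inj_onD)

section \<open>Even length\<close>

text \<open>This is the alternating sum of the degree equations, phrased with mismatch indicators so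
  that every term is a natural number.\<close>

lemma even_arc_card:
  assumes "even m" "m \<ge> 2" "v \<rightarrow>\<^bsub>DstarC m\<^esub> w"
  shows "card (mismatches odd v) + card (mismatches odd w) = m"
proof -
  obtain \<alpha> where \<alpha>: "\<alpha> \<in> circular_words m" "inlet \<alpha> = v" "outlet \<alpha> = w"
    using assms dominates_DstarC_iff[of m v w] by auto
  then have len: "length \<alpha> = m" by (simp add: circular_words_def)
  \<comment> \<open>The edge above the successor of \<open>i\<close> is the edge below
    \<open>i\<close>, and the parity of the index changes at every step, also at the wrap-around
    because \<open>m\<close> is even. Hence comparing \<open>Up\<close> with \<open>even\<close> and
    \<open>Down\<close> with \<open>odd\<close> gives equal totals.\<close>
  define f where "f i = (of_bool ((Up \<in> occupied (\<alpha> ! i)) \<noteq> even i) :: nat)" for i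
  define g where "g i = (of_bool ((Down \<in> occupied (\<alpha> ! i)) \<noteq> odd i) :: nat)" for i
  have fg: "sum f {..<m} = sum g {..<m}"
  proof (rule sum_shift_mod)
    fix i assume i: "i < m"
    have "even (Suc i mod m) \<longleftrightarrow> odd i"
      using assms(1) by (simp add: dvd_mod_iff)
    then show "f (Suc i mod m) = g i"
      using circular_words_Up[OF \<alpha>(1) i] by (simp add: f_def g_def)
  qed
  have "of_bool (v ! i \<noteq> odd i) + of_bool (w ! i \<noteq> odd i) + g i = 1 + f i" if "i < m" for i
    using that len
    by (cases "even i"; cases "\<alpha> ! i")
      (simp_all add: f_def g_def \<alpha>(2,3)[symmetric] inlet_def outlet_def)
  then have "(\<Sum>i<m. of_bool (v ! i \<noteq> odd i) + of_bool (w ! i \<noteq> odd i) + g i) = (\<Sum>i<m. 1 + f i)"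
    by (intro sum.cong) auto
  moreover have "length v = m" "length w = m" using \<alpha> len by auto
  ultimately show ?thesis
    by (simp only: card_mismatches sum.distrib fg) simp
qed

text \<open>Alternating vertical edges close up on an even cycle and leave each vertex exactly one
  horizontal edge.\<close>

lemma even_arc_map_Not:
  assumes "even m" "m \<ge> 2" "length v = m"
  shows "v \<rightarrow>\<^bsub>DstarC m\<^esub> map Not v"
  using assms
  by (intro dominates_DstarCI[where u = odd and d = even]) (auto simp: dvd_mod_iff)

text \<open>
  The vertical edges alternate, except that the flipped positions \<open>i\<close> and \<open>j\<close> interrupt the
  alternation; \<open>v\<close> mismatches \<open>odd\<close> in exactly one of them, which makes both interruptions fit.
\<close>

lemma even_arc_flips:
  assumes "even m" "m \<ge> 2" "length v = m" and ij: "i < j" "j < m"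
    and mis: "(v ! i = odd i) \<noteq> (v ! j = odd j)"
  shows "v \<rightarrow>\<^bsub>DstarC m\<^esub> map Not (v[i := \<not> v ! i, j := \<not> v ! j])"
proof (rule dominates_DstarCI)
  \<comment> \<open>At a flipped position the outlet equals the inlet, so both vertical edges must
    carry the negated bit. The alternation has one phase on the edges between \<open>i\<close> and
    \<open>j\<close> and the opposite phase elsewhere; \<open>b\<close> selects the phase that fits
    at \<open>i\<close>, and \<open>mis\<close> makes it fit at \<open>j\<close>.\<close>
  define b where "b \<longleftrightarrow> v ! i \<noteq> odd i"
  define d where "d k \<longleftrightarrow> ((i \<le> k \<and> k < j) = b) \<noteq> even k" for k
  define u where "u k \<longleftrightarrow> ((i < k \<and> k \<le> j) = b) \<noteq> odd k" for k
  show "u (Suc k mod m) = d k" if "k < m" for k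
  proof (cases "Suc k = m")
    case True
    then have "odd k" using assms(1) by auto
    with True ij show ?thesis by (auto simp: u_def d_def)
  next
    case False
    with that show ?thesis by (auto simp: u_def d_def)
  qed
  show "of_bool (v ! k) + of_bool (map Not (v[i := \<not> v ! i, j := \<not> v ! j]) ! k)
      + of_bool (u k) + of_bool (d k) = (2::nat)" if "k < m" for k
  proof -
    consider "k = i" | "k = j" | "k \<noteq> i" "k \<noteq> j" by blast
    then show ?thesis
    proof cases
      case 1
      then show ?thesis using that ij assms(3)
        by (cases "v ! i"; cases "even i") (simp_all add: u_def d_def b_def)
    next
      case 2
      then show ?thesis using that ij mis assms(3)
        by (cases "v ! j"; cases "even j") (auto simp add: u_def d_def b_def)
    next
      case 3
      then have "(i < k \<and> k \<le> j) = (i \<le> k \<and> k < j)" by auto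
      then have "u k = (\<not> d k)" by (auto simp: u_def d_def)
      with 3 show ?thesis using that assms(3) by simp
    qed
  qed
qed (use assms in auto)

text \<open>A second, purely complementing arc cancels the complement. Since the condition is
  symmetric in \<open>i\<close> and \<open>j\<close>, their order does not matter.\<close>

lemma even_reachable_flips:
  assumes "even m" "m \<ge> 2" "length v = m" "i < m" "j < m"
    and mis: "(v ! i = odd i) \<noteq> (v ! j = odd j)"
  shows "v \<rightarrow>\<^sup>*\<^bsub>DstarC m\<^esub> v[i := \<not> v ! i, j := \<not> v ! j]" (is "_ \<rightarrow>\<^sup>*\<^bsub>_\<^esub> ?w")
proof -
  interpret wf_digraph "DstarC m" by (rule wf_digraph_DstarC)
  have "i \<noteq> j" using mis by auto
  then have "v \<rightarrow>\<^bsub>DstarC m\<^esub> map Not ?w"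
    using even_arc_flips[of m v i j] even_arc_flips[of m v j i] assms
    by (metis linorder_neqE_nat list_update_swap)
  moreover have "map Not ?w \<rightarrow>\<^bsub>DstarC m\<^esub> map Not (map Not ?w)"
    by (rule even_arc_map_Not) (use assms in simp_all)
  moreover have "map Not (map Not ?w) = ?w"
    by (simp add: list_eq_iff_nth_eq)
  ultimately show ?thesis
    by (metis reachable_adjI reachable_adj_trans)
qed

text \<open>Mismatch sets of equal size that differ have elements \<open>i\<close> and
  \<open>j\<close> missing from each other. Flipping both positions exchanges \<open>i\<close> for
  \<open>j\<close>, which keeps the size and shrinks the difference.\<close>

lemma even_reachable_same_card:
  assumes "even m" "m \<ge> 2" "length v = m" "length w = m"
    "card (mismatches odd v) = card (mismatches odd w)"
  shows "v \<rightarrow>\<^sup>*\<^bsub>DstarC m\<^esub> w"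
  using assms
proof (induction "card (mismatches odd v - mismatches odd w)" arbitrary: v rule: less_induct)
  case less
  interpret wf_digraph "DstarC m" by (rule wf_digraph_DstarC)
  show ?case
  proof (cases "mismatches odd v = mismatches odd w")
    case True
    then have "v = w" using mismatches_eq_iff[of v w odd] less.prems by simp
    then show ?thesis using less.prems verts_DstarC[of m] by simp
  next
    case False
    obtain i where i: "i \<in> mismatches odd v" "i \<notin> mismatches odd w"
      using False less.prems(5) by (metis card_subset_eq finite_mismatches subsetI)
    obtain j where j: "j \<in> mismatches odd w" "j \<notin> mismatches odd v"
      using False less.prems(5) by (metis card_subset_eq finite_mismatches subsetI)
    have ij: "i < m" "j < m" "v ! i \<noteq> odd i" "v ! j = odd j" "i \<noteq> j"
      using i j less.prems by (auto simp: mismatches_def)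
    let ?u = "v[i := \<not> v ! i, j := \<not> v ! j]"
    have "?u = v[i := \<not> v ! i, j := \<not> v[i := \<not> v ! i] ! j]"
      using ij by simp
    then have mu: "mismatches odd ?u = insert j (mismatches odd v - {i})"
      using ij less.prems mismatches_flip[of i v odd] mismatches_flip[of j "v[i := \<not> v ! i]" odd]
      by simp
    have "card (mismatches odd ?u) = card (mismatches odd v)"
      unfolding mu using i j ij card_Suc_Diff1[of "mismatches odd v" i] by simp
    moreover have "mismatches odd ?u - mismatches odd w = mismatches odd v - mismatches odd w - {i}"
      unfolding mu using j by blast
    then have "card (mismatches odd ?u - mismatches odd w) < card (mismatches odd v - mismatches odd w)"
      using i by (simp add: card_Diff1_less del: card_Diff_insert)
    ultimately have "?u \<rightarrow>\<^sup>*\<^bsub>DstarC m\<^esub> w"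
      using less.prems by (intro less.hyps) simp_all
    moreover have "v \<rightarrow>\<^sup>*\<^bsub>DstarC m\<^esub> ?u"
      by (rule even_reachable_flips) (use ij less.prems in auto)
    ultimately show ?thesis by (rule reachable_trans[rotated])
  qed
qed

section \<open>The invariant |k - m/2| for even length\<close>

definition imbalance :: "bool list \<Rightarrow> nat" where
  "imbalance w = nat \<bar>int (card (mismatches odd w)) - int (length w div 2)\<bar>"

lemma imbalance_eq_iff:
  assumes "even m" "length w = m" "k \<le> m div 2"
  shows "imbalance w = k \<longleftrightarrow>
    card (mismatches odd w) = m div 2 - k \<or> card (mismatches odd w) = m div 2 + k"
  using assms unfolding imbalance_def by auto

lemma imbalance_class:
  assumes "even m" "k \<le> m div 2"
  shows "{w. length w = m \<and> imbalance w = k} =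
    {w. length w = m \<and> card (mismatches odd w) = m div 2 - k} \<union>
    {w. length w = m \<and> card (mismatches odd w) = m div 2 + k}"
  using imbalance_eq_iff[OF assms(1) _ assms(2)] by blast

lemma imbalance_le:
  assumes "even m" "length w = m"
  shows "imbalance w \<le> m div 2"
proof -
  have "card (mismatches odd w) \<le> m"
    using card_mono[OF _ mismatches_subset[of odd w]] assms by simp
  then show ?thesis using assms unfolding imbalance_def by auto
qed

lemma even_arc_imbalance:
  assumes "even m" "m \<ge> 2" "v \<rightarrow>\<^bsub>DstarC m\<^esub> w"
  shows "imbalance v = imbalance w"
proof -
  interpret wf_digraph "DstarC m" by (rule wf_digraph_DstarC)
  have "length v = m" "length w = m"
    using adj_in_verts[OF assms(3)] verts_DstarC[of m] assms(2) by auto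
  then show ?thesis
    using even_arc_card[OF assms] assms(1) unfolding imbalance_def by auto
qed

text \<open>Equal imbalance means that the mismatch counts are equal or add up to \<open>m\<close>;
  one complementing arc reduces the second case to the first.\<close>

lemma even_reachable_iff:
  assumes "even m" "m \<ge> 2" "length v = m" "length w = m"
  shows "v \<rightarrow>\<^sup>*\<^bsub>DstarC m\<^esub> w \<longleftrightarrow> imbalance v = imbalance w"
proof
  interpret wf_digraph "DstarC m" by (rule wf_digraph_DstarC)
  show "imbalance v = imbalance w" if "v \<rightarrow>\<^sup>*\<^bsub>DstarC m\<^esub> w"
    using that
  proof (induction rule: reachable_induct)
    case (step x y)
    then show ?case using even_arc_imbalance[OF assms(1,2)] by simp
  qed simp
  assume "imbalance v = imbalance w"
  then consider "card (mismatches odd v) = card (mismatches odd w)"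
    | "card (mismatches odd v) + card (mismatches odd w) = m"
    using assms unfolding imbalance_def by fastforce
  then show "v \<rightarrow>\<^sup>*\<^bsub>DstarC m\<^esub> w"
  proof cases
    case 1
    then show ?thesis using assms even_reachable_same_card by blast
  next
    case 2
    then have "map Not v \<rightarrow>\<^sup>*\<^bsub>DstarC m\<^esub> w"
      by (intro even_reachable_same_card) (use assms in \<open>auto simp: card_mismatches_map_Not\<close>)
    then show ?thesis
      using even_arc_map_Not[OF assms(1-3)] by (rule adj_reachable_trans[rotated])
  qed
qed

section \<open>Sizes of the classes for even length\<close>

lemma card_imbalance_0:
  assumes "even m"
  shows "card {w. length w = m \<and> imbalance w = 0} = m choose (m div 2)"
proof -
  have "{w. length w = m \<and> imbalance w = 0} =
      {w. length w = m \<and> card (mismatches odd w) = m div 2}"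
    using assms by (auto simp: imbalance_eq_iff)
  then show ?thesis by (simp add: card_words_mismatches)
qed

text \<open>For positive \<open>s\<close> the class splits into two disjoint slices, of equal size
  by the symmetry of binomial coefficients.\<close>

lemma card_imbalance_pos:
  assumes "even m" "1 \<le> s" "s \<le> m div 2"
  shows "card {w. length w = m \<and> imbalance w = s} = 2 * (m choose (m div 2 - s))"
proof -
  have fin: "finite {w. length w = m \<and> card (mismatches odd w) = k}" for k
    by (rule finite_subset[OF _ finite_lists_length_eq[of UNIV m]]) auto
  note imbalance_class[OF assms(1,3)]
  moreover have "{w. length w = m \<and> card (mismatches odd w) = m div 2 - s} \<inter>
      {w. length w = m \<and> card (mismatches odd w) = m div 2 + s} = {}"
    using assms by auto
  ultimately have "card {w. length w = m \<and> imbalance w = s} =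
      (m choose (m div 2 - s)) + (m choose (m div 2 + s))"
    using fin by (simp add: card_Un_disjoint card_words_mismatches)
  moreover have "m choose (m div 2 + s) = m choose (m div 2 - s)"
  proof -
    have "m - (m div 2 + s) = m div 2 - s" using assms by auto
    then show ?thesis using binomial_symmetric[of "m div 2 + s" m] assms by auto
  qed
  ultimately show ?thesis by simp
qed

text \<open>A constant word differs from the alternating pattern in exactly half of the
  positions.\<close>

lemma imbalance_replicate:
  assumes "even m"
  shows "imbalance (replicate m b) = 0"
proof -
  have *: "card (mismatches odd (replicate (2 * n) False)) = n" for n
  proof -
    have "card (mismatches odd (replicate (2 * n) False)) = (\<Sum>i<2 * n. of_bool (odd i))"
      unfolding card_mismatches by (rule sum.cong) auto
    also have "\<dots> = n"
      by (induction n) simp_all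
    finally show ?thesis .
  qed
  obtain n where "m = 2 * n" using assms by blast
  moreover have "map Not (replicate m False) = replicate m True" by simp
  ultimately have "card (mismatches odd (replicate m b)) = n"
    using *[of n] card_mismatches_map_Not[of odd "replicate m False"] by (cases b) simp_all
  with \<open>m = 2 * n\<close> show ?thesis by (simp add: imbalance_def)
qed

section \<open>Odd length\<close>

abbreviation ones :: "bool list \<Rightarrow> nat" where
  "ones w \<equiv> card (mismatches (\<lambda>_. False) w)"

text \<open>Summing the degrees around the column counts every vertical edge twice, so
  \<open>ones v + ones w\<close> is even.\<close>

lemma odd_arc_parity:
  assumes "m \<ge> 1" "v \<rightarrow>\<^bsub>DstarC m\<^esub> w"
  shows "even (ones v) = even (ones w)"
proof -
  obtain \<alpha> where \<alpha>: "\<alpha> \<in> circular_words m" "inlet \<alpha> = v" "outlet \<alpha> = w"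
    using assms dominates_DstarC_iff[of m v w] by auto
  then have len: "length \<alpha> = m" by (simp add: circular_words_def)
  define f where "f i = (of_bool (Up \<in> occupied (\<alpha> ! i)) :: nat)" for i
  define g where "g i = (of_bool (Down \<in> occupied (\<alpha> ! i)) :: nat)" for i
  have fg: "sum f {..<m} = sum g {..<m}"
    using circular_words_Up[OF \<alpha>(1)] by (intro sum_shift_mod) (simp add: f_def g_def)
  have "of_bool (v ! i \<noteq> False) + of_bool (w ! i \<noteq> False) + f i + g i = 2" if "i < m" for i
    using occupied_degree[of "\<alpha> ! i"] that len
    by (simp add: f_def g_def \<alpha>(2,3)[symmetric] inlet_def outlet_def)
  then have "(\<Sum>i<m. of_bool (v ! i \<noteq> False) + of_bool (w ! i \<noteq> False) + f i + g i) = (\<Sum>i<m. 2)"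
    by (intro sum.cong) auto
  moreover have "length v = m" "length w = m" using \<alpha> len by auto
  ultimately have "ones v + ones w + 2 * sum g {..<m} = 2 * m"
    by (simp only: card_mismatches sum.distrib fg) simp
  then show ?thesis by presburger
qed

text \<open>The vertical edges alternate except at \<open>j\<close>, where both carry the negation
  of \<open>v ! j\<close>. One interruption is what an alternation around an odd cycle needs in
  order to close up.\<close>

lemma odd_arc_flip:
  assumes "odd m" "length v = m" "j < m"
  shows "v \<rightarrow>\<^bsub>DstarC m\<^esub> map Not (v[j := \<not> v ! j])"
proof (rule dominates_DstarCI)
  define d where "d k \<longleftrightarrow> ((j \<le> k) = even (k + j)) \<noteq> v ! j" for k
  define u where "u k \<longleftrightarrow> ((j < k) = odd (k + j)) \<noteq> v ! j" for k
  show "u (Suc k mod m) = d k" if "k < m" for k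
  proof (cases "Suc k = m")
    case True
    then have "even k" using assms(1) by auto
    with True assms(3) show ?thesis by (auto simp: u_def d_def)
  next
    case False
    with that show ?thesis by (auto simp: u_def d_def)
  qed
  show "of_bool (v ! k) + of_bool (map Not (v[j := \<not> v ! j]) ! k)
      + of_bool (u k) + of_bool (d k) = (2::nat)" if "k < m" for k
    using that assms by (cases "k = j") (auto simp: u_def d_def)
qed (use assms in \<open>auto simp: odd_pos Suc_le_eq\<close>)

text \<open>Two single-flip arcs in a row: their complementations cancel and the two flips
  remain.\<close>

lemma odd_reachable_flips:
  assumes "odd m" "length v = m" "i < m" "j < m" "i \<noteq> j"
  shows "v \<rightarrow>\<^sup>*\<^bsub>DstarC m\<^esub> v[i := \<not> v ! i, j := \<not> v ! j]"
proof -
  interpret wf_digraph "DstarC m" by (rule wf_digraph_DstarC)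
  let ?u = "map Not (v[i := \<not> v ! i])"
  have "v \<rightarrow>\<^bsub>DstarC m\<^esub> ?u" using assms by (intro odd_arc_flip)
  moreover have "?u \<rightarrow>\<^bsub>DstarC m\<^esub> map Not (?u[j := \<not> ?u ! j])"
    using assms by (intro odd_arc_flip) simp_all
  moreover have "map Not (?u[j := \<not> ?u ! j]) = v[i := \<not> v ! i, j := \<not> v ! j]"
    using assms by (auto simp: list_eq_iff_nth_eq nth_list_update)
  ultimately show ?thesis
    by (metis reachable_adjI reachable_adj_trans)
qed

lemma even_ones_flip:
  assumes "i < length w"
  shows "even (ones (w[i := \<not> w ! i])) \<longleftrightarrow> odd (ones w)"
proof (cases "w ! i")
  case True
  with assms have "i \<in> mismatches (\<lambda>_. False) w" by (simp add: mismatches_def)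
  then have "Suc (card (mismatches (\<lambda>_. False) w - {i})) = ones w"
    by (rule card_Suc_Diff1[OF finite_mismatches])
  moreover have "mismatches (\<lambda>_. False) (w[i := \<not> w ! i]) = mismatches (\<lambda>_. False) w - {i}"
    using True assms mismatches_flip[of i w "\<lambda>_. False"] by simp
  ultimately show ?thesis by (metis even_Suc)
next
  case False
  then have "i \<notin> mismatches (\<lambda>_. False) w" by (simp add: mismatches_def)
  then show ?thesis
    using False assms mismatches_flip[of i w "\<lambda>_. False"] by simp
qed

text \<open>Induction on the Hamming distance to \<open>w\<close>. Equal parity rules out distance
  one, so two differing positions can be corrected together.\<close>

lemma odd_reachable_same_parity:
  assumes "odd m" "length v = m" "length w = m" "even (ones v) = even (ones w)"
  shows "v \<rightarrow>\<^sup>*\<^bsub>DstarC m\<^esub> w"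
  using assms
proof (induction "card (mismatches ((!) w) v)" arbitrary: v rule: less_induct)
  case less
  interpret wf_digraph "DstarC m" by (rule wf_digraph_DstarC)
  show ?case
  proof (cases "v = w")
    case True
    then show ?thesis using less.prems verts_DstarC[of m] by (simp add: odd_pos Suc_le_eq)
  next
    case False
    then obtain i where i: "i < m" "v ! i \<noteq> w ! i"
      using less.prems by (auto simp: list_eq_iff_nth_eq)
    let ?x = "v[i := \<not> v ! i]"
    \<comment> \<open>A single flip changes the parity of the ones, so it cannot produce
      \<open>w\<close>; this yields the second differing position.\<close>
    have "?x \<noteq> w"
      using even_ones_flip[of i v] less.prems i by auto
    then obtain j where j: "j < m" "?x ! j \<noteq> w ! j"
      using less.prems by (auto simp: list_eq_iff_nth_eq)
    then have "i \<noteq> j" using i less.prems by auto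
    let ?u = "v[i := \<not> v ! i, j := \<not> v ! j]"
    have u: "?u = ?x[j := \<not> ?x ! j]" using \<open>i \<noteq> j\<close> by simp
    have "even (ones ?u) = even (ones w)"
      unfolding u using less.prems i j even_ones_flip[of i v] even_ones_flip[of j ?x]
      by (metis length_list_update)
    moreover have "mismatches ((!) w) ?u \<subset> mismatches ((!) w) v"
      using i j \<open>i \<noteq> j\<close> less.prems
      by (auto simp: mismatches_def nth_list_update psubset_eq split: if_splits)
    ultimately have "?u \<rightarrow>\<^sup>*\<^bsub>DstarC m\<^esub> w"
      using less.prems by (intro less.hyps) (auto intro: psubset_card_mono)
    moreover have "v \<rightarrow>\<^sup>*\<^bsub>DstarC m\<^esub> ?u"
      by (rule odd_reachable_flips) (use i j \<open>i \<noteq> j\<close> less.prems in auto)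
    ultimately show ?thesis by (rule reachable_trans[rotated])
  qed
qed

lemma odd_reachable_iff:
  assumes "odd m" "length v = m" "length w = m"
  shows "v \<rightarrow>\<^sup>*\<^bsub>DstarC m\<^esub> w \<longleftrightarrow> even (ones v) = even (ones w)"
proof
  interpret wf_digraph "DstarC m" by (rule wf_digraph_DstarC)
  have "m \<ge> 1" using assms(1) by (simp add: odd_pos Suc_le_eq)
  show "even (ones v) = even (ones w)" if "v \<rightarrow>\<^sup>*\<^bsub>DstarC m\<^esub> w"
    using that
  proof (induction rule: reachable_induct)
    case (step x y)
    then show ?case using odd_arc_parity[OF \<open>m \<ge> 1\<close>] by simp
  qed simp
qed (use assms odd_reachable_same_parity in blast)

section \<open>Complementing letters, the symmetry behind the isomorphism for odd length\<close>

fun complement :: "letter \<Rightarrow> letter" where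
  "complement La = Lf"
| "complement Lb = Le"
| "complement Lc = Ld"
| "complement Ld = Lc"
| "complement Le = Lb"
| "complement Lf = La"

lemma occupied_complement [simp]: "x \<in> occupied (complement l) \<longleftrightarrow> x \<notin> occupied l"
  by (cases l; cases x) simp_all

lemma complement_complement [simp]: "complement (complement l) = l"
  by (cases l) simp_all

lemma inlet_map_complement: "inlet (map complement \<alpha>) = map Not (inlet \<alpha>)"
  by (simp add: inlet_def)

lemma outlet_map_complement: "outlet (map complement \<alpha>) = map Not (outlet \<alpha>)"
  by (simp add: outlet_def)

lemma map_complement_circular:
  assumes "\<alpha> \<in> circular_words m"
  shows "map complement \<alpha> \<in> circular_words m"
proof -
  have "(map complement \<alpha> ! i, map complement \<alpha> ! (Suc i mod m)) \<in> parcs D_ud" if "i < m" for i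
  proof -
    have "Suc i mod m < m" using that by simp
    then show ?thesis
      using assms that by (simp add: circular_words_def D_ud_def)
  qed
  then show ?thesis
    using assms by (simp add: circular_words_def)
qed

text \<open>Source and target are both subgraphs of \<open>DstarC m\<close>, so the tail and head
  maps of the image are the projections already used there.\<close>

definition complement_iso ::
    "(bool list, bool list \<times> letter list, bool list, bool list \<times> letter list) digraph_isomorphism" where
  "complement_iso = \<lparr> iso_verts = map Not, iso_arcs = map_prod (map Not) (map complement),
     iso_head = (\<lambda>(v, \<beta>). outlet \<beta>), iso_tail = fst \<rparr>"

lemma map_Not_map_Not [simp]: "map Not (map Not w) = w"
  by (simp add: list_eq_iff_nth_eq)

lemma map_complement_map_complement [simp]: "map complement (map complement \<alpha>) = \<alpha>"
  by (simp add: list_eq_iff_nth_eq)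

lemma arc_complement:
  assumes "e \<in> arcs (DstarC m)"
  shows "map_prod (map Not) (map complement) e \<in> arcs (DstarC m)"
proof -
  obtain \<alpha> \<beta> where "e = (outlet \<alpha>, \<beta>)" "(\<alpha>, \<beta>) \<in> parcs (D_C m)"
    using assms by (auto simp: DstarC_def)
  then have "map_prod (map Not) (map complement) e = (outlet (map complement \<alpha>), map complement \<beta>)"
    "(map complement \<alpha>, map complement \<beta>) \<in> parcs (D_C m)"
    by (simp_all add: D_C_arc_iff map_complement_circular inlet_map_complement
        outlet_map_complement del: map_map)
  then show ?thesis by (auto simp: DstarC_def)
qed

lemma tail_head_complement:
  "tail (DstarC m) (map_prod (map Not) (map complement) e) = map Not (tail (DstarC m) e)"
  "head (DstarC m) (map_prod (map Not) (map complement) e) = map Not (head (DstarC m) e)"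
  by (cases e; simp add: DstarC_def outlet_map_complement)+

text \<open>Complementation is an involution on words and on arcs and commutes with tail and head,
  so it carries the subgraph induced by any \<open>S\<close> onto the one induced by the image of
  \<open>S\<close>.\<close>

lemma digraph_iso_complement:
  "digraph_iso (DstarC m \<restriction> S) (DstarC m \<restriction> (map Not ` S))"
  unfolding digraph_iso_def
proof (intro exI conjI)
  let ?c = "map_prod (map Not) (map complement)"
  interpret wf_digraph "DstarC m" by (rule wf_digraph_DstarC)
  have cc: "?c (?c e) = e" for e :: "bool list \<times> letter list"
    by (cases e) (simp del: map_map)
  show "pre_digraph.digraph_isomorphism (DstarC m \<restriction> S) complement_iso"
    unfolding pre_digraph.digraph_isomorphism_def
  proof (intro conjI ballI)
    show "wf_digraph (DstarC m \<restriction> S)" by (rule wellformed_induce_subgraph)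
    show "inj_on (iso_verts complement_iso) (verts (DstarC m \<restriction> S))"
      by (rule inj_on_inverseI[where g = "map Not"]) (simp add: complement_iso_def del: map_map)
    show "inj_on (iso_arcs complement_iso) (arcs (DstarC m \<restriction> S))"
      by (rule inj_on_inverseI[where g = ?c]) (simp add: complement_iso_def cc)
  qed (auto simp: complement_iso_def DstarC_def outlet_map_complement)
  have mem: "map Not w \<in> map Not ` S \<longleftrightarrow> w \<in> S" for w
    by (metis image_iff map_Not_map_Not)
  have "arcs (DstarC m \<restriction> (map Not ` S)) = ?c ` arcs (DstarC m \<restriction> S)"
  proof (intro equalityI subsetI)
    fix e assume e: "e \<in> arcs (DstarC m \<restriction> (map Not ` S))"
    have "?c e \<in> arcs (DstarC m \<restriction> S)"
      using e arc_complement[of e m] mem map_Not_map_Not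
      by (auto simp: tail_head_complement simp del: map_map)
    then show "e \<in> ?c ` arcs (DstarC m \<restriction> S)" by (rule rev_image_eqI) (simp add: cc)
  next
    fix e assume "e \<in> ?c ` arcs (DstarC m \<restriction> S)"
    then obtain e' where "e = ?c e'" "e' \<in> arcs (DstarC m \<restriction> S)" by (rule imageE)
    then show "e \<in> arcs (DstarC m \<restriction> (map Not ` S))"
      by (simp add: tail_head_complement mem arc_complement)
  qed
  then show "DstarC m \<restriction> (map Not ` S) = app_iso complement_iso (DstarC m \<restriction> S)"
    by (intro pre_digraph.equality) (simp_all add: complement_iso_def DstarC_def)
qed

section \<open>Parity classes for odd length and their sizes\<close>

lemma ones_replicate: "ones (replicate m b) = (if b then m else 0)"
proof -
  have "mismatches (\<lambda>_. False) (replicate m b) = (if b then {..<m} else {})"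
    by (auto simp: mismatches_def)
  then show ?thesis by simp
qed

text \<open>Complementing turns \<open>k\<close> ones into \<open>m - k\<close>, which has the other
  parity because \<open>m\<close> is odd.\<close>

lemma map_Not_odd_ones:
  assumes "odd m"
  shows "map Not ` {w. length w = m \<and> even (ones w) = b} = {w. length w = m \<and> even (ones w) = (\<not> b)}"
proof -
  have *: "even (ones (map Not w)) = odd (ones w)" if "length w = m" for w
  proof -
    have "ones w \<le> m"
      using card_mono[OF _ mismatches_subset[of "\<lambda>_. False" w]] that by simp
    then show ?thesis
      using assms that by (simp add: card_mismatches_map_Not)
  qed
  show ?thesis
  proof (intro equalityI subsetI)
    fix w assume "w \<in> {w. length w = m \<and> even (ones w) = (\<not> b)}"
    then have "map Not w \<in> {w. length w = m \<and> even (ones w) = b}" using * by simp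
    then show "w \<in> map Not ` {w. length w = m \<and> even (ones w) = b}"
      by (rule rev_image_eqI) (simp del: map_map)
  qed (use * in auto)
qed

text \<open>Complementation matches the two parity classes, so each holds half of the
  \<open>2 ^ m\<close> words.\<close>

lemma card_parity_class:
  assumes "odd m"
  shows "card {w. length w = m \<and> even (ones w) = b} = 2 ^ (m - 1)"
proof -
  let ?P = "\<lambda>b. {w. length w = m \<and> even (ones w) = b}"
  have fin: "finite {w :: bool list. length w = m}"
    using finite_lists_length_eq[of "UNIV :: bool set" m] by simp
  have "card (?P b) = card (map Not ` ?P b)"
    by (rule card_image[symmetric], rule inj_on_inverseI[where g = "map Not"]) (rule map_Not_map_Not)
  then have "card (?P b) = card (?P (\<not> b))"
    using map_Not_odd_ones[OF assms] by simp
  moreover have "card (?P b) + card (?P (\<not> b)) = card (?P b \<union> ?P (\<not> b))"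
    by (rule card_Un_disjoint[symmetric]) (auto intro: finite_subset[OF _ fin])
  moreover have "?P b \<union> ?P (\<not> b) = {w. length w = m}" by auto
  moreover have "card {w :: bool list. length w = m} = 2 ^ m"
    using card_lists_length_eq[of "UNIV :: bool set" m] by simp
  moreover obtain n where "m = Suc n" using assms by (cases m) auto
  ultimately show ?thesis by simp
qed

section \<open>The component structure\<close>

lemma even_components:
  assumes "even m" "m \<ge> 2"
  defines "C \<equiv> \<lambda>k. DstarC m \<restriction> {v \<in> verts (DstarC m). imbalance v = k}"
  shows "pre_digraph.sccs (DstarC m) = C ` {0..m div 2}"
    and "card (pre_digraph.sccs (DstarC m)) = m div 2 + 1"
    and "pre_digraph.Union (DstarC m) (C ` {0..m div 2}) = DstarC m"
proof -
  interpret wf_digraph "DstarC m" by (rule wf_digraph_DstarC)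
  have V: "verts (DstarC m) = {w. length w = m}" using assms(2) by (simp add: verts_DstarC)
  have img: "imbalance ` verts (DstarC m) = {0..m div 2}"
  proof (intro equalityI subsetI)
    fix s assume s: "s \<in> {0..m div 2}"
    \<comment> \<open>Every value up to \<open>m div 2\<close> is attained, since the class sizes
      are multiples of nonzero binomial coefficients.\<close>
    have "card {w. length w = m \<and> imbalance w = s} \<noteq> 0"
      using assms(1) s card_imbalance_0[of m] card_imbalance_pos[of m s] by (cases "s = 0") auto
    then have "{w. length w = m \<and> imbalance w = s} \<noteq> {}" by fastforce
    then show "s \<in> imbalance ` verts (DstarC m)" unfolding V by blast
  qed (use assms(1) V imbalance_le in auto)
  show 1: "sccs = C ` {0..m div 2}"
    unfolding C_def img[symmetric]
    by (rule sccs_eq_levels) (use even_reachable_iff[OF assms(1,2)] in \<open>simp add: V\<close>)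
  show "card sccs = m div 2 + 1"
    using card_levels[of imbalance] by (simp add: 1 img C_def)
  have "imbalance (tail (DstarC m) e) = imbalance (head (DstarC m) e)" if "e \<in> arcs (DstarC m)" for e
    using even_arc_imbalance[OF assms(1,2)] that by (auto simp: arcs_ends_conv)
  then show "Union (C ` {0..m div 2}) = DstarC m"
    using Union_levels[of imbalance] by (simp add: img C_def)
qed

text \<open>An arc sends the mismatch count \<open>k\<close> to \<open>m - k\<close> and so
  exchanges the slices \<open>m div 2 - s\<close> and \<open>m div 2 + s\<close>, which are distinct
  for positive \<open>s\<close>.\<close>

lemma even_bipartite:
  assumes "even m" "m \<ge> 2" "1 \<le> s" "s \<le> m div 2"
  shows "bipartite_digraph (DstarC m \<restriction> {v \<in> verts (DstarC m). imbalance v = s})"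
  unfolding bipartite_digraph_def
proof (intro exI conjI ballI)
  let ?G = "DstarC m \<restriction> {v \<in> verts (DstarC m). imbalance v = s}"
  let ?U = "{w. length w = m \<and> card (mismatches odd w) = m div 2 - s}"
  let ?W = "{w. length w = m \<and> card (mismatches odd w) = m div 2 + s}"
  have V: "verts (DstarC m) = {w. length w = m}" using assms(2) by (simp add: verts_DstarC)
  show VG: "verts ?G = ?U \<union> ?W"
    using imbalance_class[OF assms(1,4)] by (simp add: V)
  show "?U \<inter> ?W = {}" using assms by auto
  fix e assume e: "e \<in> arcs ?G"
  then have "tail ?G e \<in> ?U \<union> ?W" "head ?G e \<in> ?U \<union> ?W"
    unfolding VG[symmetric] by simp_all
  moreover have "tail (DstarC m) e \<rightarrow>\<^bsub>DstarC m\<^esub> head (DstarC m) e"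
    using e by (auto simp: arcs_ends_conv)
  then have "card (mismatches odd (tail ?G e)) + card (mismatches odd (head ?G e)) = m"
    using even_arc_card[OF assms(1,2)] by simp
  ultimately show "(tail ?G e \<in> ?U \<and> head ?G e \<in> ?W) \<or> (tail ?G e \<in> ?W \<and> head ?G e \<in> ?U)"
    using assms by auto
qed

lemma odd_components:
  assumes "odd m"
  defines "C \<equiv> \<lambda>b. DstarC m \<restriction> {v \<in> verts (DstarC m). even (ones v) = b}"
  shows "pre_digraph.sccs (DstarC m) = {C False, C True}"
    and "card (pre_digraph.sccs (DstarC m)) = 2"
    and "pre_digraph.Union (DstarC m) {C False, C True} = DstarC m"
proof -
  interpret wf_digraph "DstarC m" by (rule wf_digraph_DstarC)
  have m: "m \<ge> 1" using assms(1) by (simp add: odd_pos Suc_le_eq)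
  have V: "verts (DstarC m) = {w. length w = m}" using m by (simp add: verts_DstarC)
  \<comment> \<open>The two constant words represent the two parities, because \<open>m\<close> is
    odd.\<close>
  have "b \<in> (\<lambda>v. even (ones v)) ` verts (DstarC m)" for b
    by (rule image_eqI[where x = "replicate m (\<not> b)"])
      (use assms(1) in \<open>simp_all add: V ones_replicate\<close>)
  then have img: "(\<lambda>v. even (ones v)) ` verts (DstarC m) = {False, True}"
    by blast
  have "sccs = C ` (\<lambda>v. even (ones v)) ` verts (DstarC m)"
    unfolding C_def
    by (rule sccs_eq_levels) (use odd_reachable_iff[OF assms(1)] in \<open>simp add: V\<close>)
  then show 1: "sccs = {C False, C True}"
    by (simp add: img)
  show "card sccs = 2"
    using card_levels[of "\<lambda>v. even (ones v)"] by (simp add: 1 img C_def)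
  have "even (ones (tail (DstarC m) e)) = even (ones (head (DstarC m) e))"
    if "e \<in> arcs (DstarC m)" for e
    using odd_arc_parity[OF m] that by (auto simp: arcs_ends_conv)
  then show "Union {C False, C True} = DstarC m"
    using Union_levels[of "\<lambda>v. even (ones v)"] by (simp add: img C_def)
qed

theorem theorem5:
  shows "(\<forall>m::nat. even m \<and> m \<ge> 2 \<longrightarrow>
      (\<exists>(A :: (bool list, bool list \<times> letter list) pre_digraph)
        (B :: nat \<Rightarrow> (bool list, bool list \<times> letter list) pre_digraph).
          pre_digraph.sccs (DstarC m) = insert A (B ` {1..m div 2})
        \<and> card (pre_digraph.sccs (DstarC m)) = m div 2 + 1
        \<and> DstarC m = pre_digraph.Union (DstarC m) (insert A (B ` {1..m div 2}))
        \<and> replicate m True \<in> verts A \<and> replicate m False \<in> verts A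
        \<and> (\<forall>s\<in>{1..m div 2}. bipartite_digraph (B s))
        \<and> (\<forall>s\<in>{1..m div 2}. card (verts (B s)) = 2 * (m choose (m div 2 - s)))
        \<and> card (verts A) = m choose (m div 2)))
    \<and> (\<forall>m::nat. odd m \<longrightarrow>
      (\<exists>(A :: (bool list, bool list \<times> letter list) pre_digraph)
        (N :: (bool list, bool list \<times> letter list) pre_digraph).
          pre_digraph.sccs (DstarC m) = {A, N}
        \<and> card (pre_digraph.sccs (DstarC m)) = 2
        \<and> DstarC m = pre_digraph.Union (DstarC m) {A, N}
        \<and> replicate m True \<in> verts A \<and> replicate m False \<in> verts N
        \<and> digraph_iso A N
        \<and> card (verts A) = 2 ^ (m - 1) \<and> card (verts N) = 2 ^ (m - 1)))"
proof (intro conjI allI impI)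
  fix m :: nat
  assume m: "even m \<and> m \<ge> 2"
  define C where "C k = DstarC m \<restriction> {v \<in> verts (DstarC m). imbalance v = k}" for k
  note comps = even_components[OF conjunct1[OF m] conjunct2[OF m], folded C_def]
  have VC: "verts (C k) = {w. length w = m \<and> imbalance w = k}" for k
    using m by (simp add: C_def verts_DstarC)
  \<comment> \<open>Level 0 plays the role of \<open>A\<close>, and the positive levels are the
    bipartite components.\<close>
  have ins: "C ` {0..m div 2} = insert (C 0) (C ` {1..m div 2})"
    by (simp add: atLeastAtMost_insertL[symmetric, of 0])
  show "\<exists>A B. pre_digraph.sccs (DstarC m) = insert A (B ` {1..m div 2})
      \<and> card (pre_digraph.sccs (DstarC m)) = m div 2 + 1
      \<and> DstarC m = pre_digraph.Union (DstarC m) (insert A (B ` {1..m div 2}))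
      \<and> replicate m True \<in> verts A \<and> replicate m False \<in> verts A
      \<and> (\<forall>s\<in>{1..m div 2}. bipartite_digraph (B s))
      \<and> (\<forall>s\<in>{1..m div 2}. card (verts (B s)) = 2 * (m choose (m div 2 - s)))
      \<and> card (verts A) = m choose (m div 2)"
  proof (intro exI conjI ballI)
    show "pre_digraph.sccs (DstarC m) = insert (C 0) (C ` {1..m div 2})"
      using comps(1) ins by simp
    show "card (pre_digraph.sccs (DstarC m)) = m div 2 + 1" by (rule comps(2))
    show "DstarC m = pre_digraph.Union (DstarC m) (insert (C 0) (C ` {1..m div 2}))"
      using comps(3) ins by simp
    show "replicate m True \<in> verts (C 0)" "replicate m False \<in> verts (C 0)"
      using m by (simp_all add: VC imbalance_replicate)
    show "card (verts (C 0)) = m choose (m div 2)"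
      using m by (simp add: VC card_imbalance_0)
    fix s assume s: "s \<in> {1..m div 2}"
    show "bipartite_digraph (C s)"
      unfolding C_def using m s by (intro even_bipartite) auto
    show "card (verts (C s)) = 2 * (m choose (m div 2 - s))"
      using m s by (simp add: VC card_imbalance_pos)
  qed
next
  fix m :: nat
  assume m: "odd m"
  define C where "C b = DstarC m \<restriction> {v \<in> verts (DstarC m). even (ones v) = b}" for b
  note comps = odd_components[OF m, folded C_def]
  have V: "verts (DstarC m) = {w. length w = m}"
    using m by (intro verts_DstarC) (simp add: odd_pos Suc_le_eq)
  show "\<exists>A N. pre_digraph.sccs (DstarC m) = {A, N}
      \<and> card (pre_digraph.sccs (DstarC m)) = 2
      \<and> DstarC m = pre_digraph.Union (DstarC m) {A, N}
      \<and> replicate m True \<in> verts A \<and> replicate m False \<in> verts N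
      \<and> digraph_iso A N
      \<and> card (verts A) = 2 ^ (m - 1) \<and> card (verts N) = 2 ^ (m - 1)"
  proof (intro exI conjI)
    \<comment> \<open>The all-ones word has an odd number of ones, so \<open>A\<close> is
      \<open>C False\<close>; the zero word puts \<open>N\<close> at \<open>C True\<close>.\<close>
    show "pre_digraph.sccs (DstarC m) = {C False, C True}" by (rule comps(1))
    show "card (pre_digraph.sccs (DstarC m)) = 2" by (rule comps(2))
    show "DstarC m = pre_digraph.Union (DstarC m) {C False, C True}" by (rule comps(3)[symmetric])
    show "replicate m True \<in> verts (C False)" "replicate m False \<in> verts (C True)"
      using m by (simp_all add: C_def V ones_replicate)
    show "card (verts (C False)) = 2 ^ (m - 1)" "card (verts (C True)) = 2 ^ (m - 1)"
      using card_parity_class[OF m, of False] card_parity_class[OF m, of True]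
      by (simp_all add: C_def V)
    have "C True = DstarC m \<restriction> (map Not ` {v \<in> verts (DstarC m). even (ones v) = False})"
      using map_Not_odd_ones[OF m, of False] by (simp add: C_def V)
    then show "digraph_iso (C False) (C True)"
      unfolding C_def using digraph_iso_complement[of m "{v \<in> verts (DstarC m). even (ones v) = False}"]
      by simp
  qed
qed

end
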